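(* Let $G_1$ be an $r_1$-regular graph on $n_1$ vertices and $m_1$ edges, and $G_2$ an arbitrary graph on $n_2$ vertices. Then, as an identity of rational functions in $x$, $$\phi(A(G_1 \ominus G_2); x) = (\phi(A(G_2); x))^{m_1} \cdot (x - \Gamma_{A(G_2)}(x))^{m_1-n_1} \cdot \prod_{i=1}^{n_1} \left(x^2 - \Gamma_{A(G_2)}(x)\,x - \lambda_i(G_1) - r_1\right).$$
   Context: All graphs are finite, simple and undirected. For a graph $G$, $A(G)$ is its adjacency matrix and $\phi(M;x)=\det(xI-M)$. The adjacency eigenvalues of a graph $G$ on $n$ vertices are $\lambda_1(G)\ge\dots\ge\lambda_n(G)$. For an $n\times n$ matrix $M$, the $M$-coronal is the rational function $\Gamma_M(x)=\mathbf{1}_n^T(xI_n-M)^{-1}\mathbf{1}_n$, where $\mathbf{1}_n$ is the all-ones column vector. The subdivision graph $\mathcal{S}(G)$ is obtained from $G$ by inserting a new vertex into every edge of $G$; $I(G)$ denotes the set of these inserted vertices. The subdivision-edge corona $G_1\ominus G_2$ of two vertex-disjoint graphs is the graph obtained from $\mathcal{S}(G_1)$ and $|I(G_1)|$ copies of $G_2$, all vertex-disjoint, by joining the $i$th vertex of $I(G_1)$ to every vertex in the $i$th copy of $G_2$. *)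

theory Defs
  imports
    "Graph_Theory.Pair_Digraph"
    "Jordan_Normal_Form.Char_Poly"
    "Jordan_Normal_Form.Gauss_Jordan_Elimination"
begin

text \<open>
  A finite simple undirected graph is a \<^const>\<open>pair_graph\<close>: finitely many vertices, and a
  symmetric, irreflexive set of arcs. Each undirected edge is thus represented by two arcs;
  the edge itself is the unordered pair of its end points.
\<close>

definition uedges :: "'a pair_pre_digraph \<Rightarrow> 'a set set" where
  "uedges G = {{u, v} | u v. (u, v) \<in> parcs G}"

definition regular_graph :: "'a pair_pre_digraph \<Rightarrow> nat \<Rightarrow> bool" where
  "regular_graph G r \<longleftrightarrow> (\<forall>v \<in> pverts G. out_degree (with_proj G) v = r)"

text \<open>The inserted vertex on the edge \<open>e\<close> is \<open>Inr e\<close>.\<close>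

definition inserted_verts :: "'a pair_pre_digraph \<Rightarrow> ('a + 'a set) set" where
  "inserted_verts G = Inr ` uedges G"

definition subdivision_graph :: "'a pair_pre_digraph \<Rightarrow> ('a + 'a set) pair_pre_digraph" where
  "subdivision_graph G =
    \<lparr> pverts = Inl ` pverts G \<union> inserted_verts G,
      parcs = {(Inl v, Inr e) | v e. e \<in> uedges G \<and> v \<in> e}
            \<union> {(Inr e, Inl v) | v e. e \<in> uedges G \<and> v \<in> e} \<rparr>"

text \<open>
  The vertices \<open>Inl w\<close> are those of the subdivision graph of \<open>G\<close>; \<open>Inr (w, v)\<close> is the vertex \<open>v\<close>
  in the copy of \<open>H\<close> belonging to the inserted vertex \<open>w\<close>.
\<close>

definition subdivision_edge_corona ::
  "'a pair_pre_digraph \<Rightarrow> 'b pair_pre_digraph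
    \<Rightarrow> (('a + 'a set) + ('a + 'a set) \<times> 'b) pair_pre_digraph"  (infixl "\<ominus>\<^sub>e" 65) where
  "G \<ominus>\<^sub>e H =
    \<lparr> pverts = Inl ` pverts (subdivision_graph G) \<union> Inr ` (inserted_verts G \<times> pverts H),
      parcs = {(Inl x, Inl y) | x y. (x, y) \<in> parcs (subdivision_graph G)}
            \<union> {(Inr (w, u), Inr (w, v)) | w u v. w \<in> inserted_verts G \<and> (u, v) \<in> parcs H}
            \<union> {(Inl w, Inr (w, v)) | w v. w \<in> inserted_verts G \<and> v \<in> pverts H}
            \<union> {(Inr (w, v), Inl w) | w v. w \<in> inserted_verts G \<and> v \<in> pverts H} \<rparr>"

definition vertex_enum :: "'a pair_pre_digraph \<Rightarrow> 'a list \<Rightarrow> bool" where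
  "vertex_enum G vs \<longleftrightarrow> distinct vs \<and> set vs = pverts G"

definition adj_matrix :: "'a pair_pre_digraph \<Rightarrow> 'a list \<Rightarrow> real mat" where
  "adj_matrix G vs =
    mat (length vs) (length vs) (\<lambda>(i, j). if (vs ! i, vs ! j) \<in> parcs G then 1 else 0)"

text \<open>
  The \<open>i\<close>-th largest real eigenvalue, \<open>i = 1, 2, \<dots>\<close>, counted with algebraic multiplicity.
\<close>

definition nth_eigenvalue :: "real mat \<Rightarrow> nat \<Rightarrow> real" where
  "nth_eigenvalue M i = rev (sorted_list_of_multiset (proots (char_poly M))) ! (i - 1)"

text \<open>
  Rational functions in the indeterminate \<open>x\<close> are elements of the fraction field of the
  polynomial ring.
\<close>

abbreviation ratfun_X :: "real poly fract" where
  "ratfun_X \<equiv> to_fract [:0, 1:]"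

abbreviation ratfun_const :: "real \<Rightarrow> real poly fract" where
  "ratfun_const c \<equiv> to_fract [:c:]"

text \<open>
  Below, \<^term>\<open>char_poly_matrix M\<close> is \<open>x I - M\<close>. Its determinant is monic, so that over the fraction
  field the inverse always exists.
\<close>

definition coronal :: "real mat \<Rightarrow> real poly fract" where
  "coronal M =
    (let ones = vec (dim_row M) (\<lambda>_. 1)
     in ones \<bullet> (the (mat_inverse (map_mat to_fract (char_poly_matrix M))) *\<^sub>v ones))"

lemma coronal_inverse_exists:
  fixes M :: "real mat"
  assumes M: "M \<in> carrier_mat n n"
  shows "mat_inverse (map_mat to_fract (char_poly_matrix M)) \<noteq> None"
proof
  let ?X = "map_mat to_fract (char_poly_matrix M)"
  assume none: "mat_inverse ?X = None"
  have X: "?X \<in> carrier_mat n n" using M by auto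
  interpret inj_idom_hom "to_fract :: real poly \<Rightarrow> real poly fract"
    by unfold_locales auto
  have "char_poly M \<noteq> 0" using degree_monic_char_poly[OF M] by auto
  hence "det ?X \<noteq> 0" unfolding char_poly_def by simp
  hence "?X \<in> Units (ring_mat TYPE(real poly fract) n ())" by (rule det_non_zero_imp_unit[OF X])
  thus False using mat_inverse(1)[OF X none, of "()"] by blast
qed

lemma pair_graph_subdivision_graph:
  assumes "pair_graph G"
  shows "pair_graph (subdivision_graph G)"
proof -
  interpret pair_graph G by fact
  have sub: "e \<subseteq> pverts G" if "e \<in> uedges G" for e
    using that arc_fst_in_verts arc_snd_in_verts unfolding uedges_def by force
  have "uedges G \<subseteq> Pow (pverts G)" using sub by auto
  hence fin: "finite (uedges G)" using finite_subset pair_finite_verts by blast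
  have finv: "finite (pverts (subdivision_graph G))"
    using fin pair_finite_verts by (auto simp: subdivision_graph_def inserted_verts_def)
  have wf: "parcs (subdivision_graph G)
      \<subseteq> pverts (subdivision_graph G) \<times> pverts (subdivision_graph G)"
    using sub by (auto simp: subdivision_graph_def inserted_verts_def)
  have fina: "finite (parcs (subdivision_graph G))"
    using finite_subset[OF wf] finv by simp
  have sym: "sym (parcs (subdivision_graph G))"
    by (auto simp: subdivision_graph_def sym_def)
  have loop: "fst e \<noteq> snd e" if "e \<in> parcs (subdivision_graph G)" for e
    using that by (auto simp: subdivision_graph_def)
  show ?thesis
    by unfold_locales (use wf finv fina sym loop in \<open>auto simp: symmetric_def\<close>)
qed

lemma pair_graph_subdivision_edge_corona:
  assumes "pair_graph G" and "pair_graph H"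
  shows "pair_graph (G \<ominus>\<^sub>e H)"
proof -
  interpret S: pair_graph "subdivision_graph G"
    using assms(1) by (rule pair_graph_subdivision_graph)
  interpret H: pair_graph H by fact
  have ins: "inserted_verts G \<subseteq> pverts (subdivision_graph G)"
    by (auto simp: subdivision_graph_def)
  hence fin: "finite (inserted_verts G)"
    using finite_subset S.pair_finite_verts by blast
  have finv: "finite (pverts (G \<ominus>\<^sub>e H))"
    using fin S.pair_finite_verts H.pair_finite_verts
    by (auto simp: subdivision_edge_corona_def)
  have wf: "parcs (G \<ominus>\<^sub>e H) \<subseteq> pverts (G \<ominus>\<^sub>e H) \<times> pverts (G \<ominus>\<^sub>e H)"
    using ins S.arc_fst_in_verts S.arc_snd_in_verts H.arc_fst_in_verts H.arc_snd_in_verts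
    by (force simp: subdivision_edge_corona_def)
  have fina: "finite (parcs (G \<ominus>\<^sub>e H))"
    using finite_subset[OF wf] finv by simp
  have symS: "(y, x) \<in> parcs (subdivision_graph G)" if "(x, y) \<in> parcs (subdivision_graph G)" for x y
    using that S.pair_sym_arcs by (auto simp: symmetric_def dest: symD)
  have symH: "(v, u) \<in> parcs H" if "(u, v) \<in> parcs H" for u v
    using that H.pair_sym_arcs by (auto simp: symmetric_def dest: symD)
  have sym: "sym (parcs (G \<ominus>\<^sub>e H))"
    using symS symH by (auto simp: subdivision_edge_corona_def sym_def)
  have loop: "fst e \<noteq> snd e" if "e \<in> parcs (G \<ominus>\<^sub>e H)" for e
    using that S.pair_no_loops H.pair_no_loops
    by (fastforce simp: subdivision_edge_corona_def)
  show ?thesis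
    by unfold_locales (use wf finv fina sym loop in \<open>auto simp: symmetric_def\<close>)
qed

end

theory Submission
  imports Defs
begin

text \<open>
  Write \<open>M = x I - A(G2)\<close> and \<open>y = x - \<Gamma>\<close>, where \<open>\<Gamma>\<close> is the coronal of \<open>A(G2)\<close>. The columns of
  \<open>x I - A\<close> belonging to the copies of \<open>G2\<close> are used to clear the columns of the inserted vertices:
  with \<open>u = M\<^sup>-\<^sup>1 1\<close>, this replaces the diagonal entry \<open>x\<close> of each inserted vertex by
  \<open>x - 1\<^sup>T u = y\<close> and splits off one factor \<open>det M\<close> per edge. What remains is the block matrix
  \<open>[x I, -B; -B\<^sup>T, y I]\<close> with \<open>B\<close> the incidence matrix of \<open>G1\<close>; multiplying it by
  \<open>[y I, 0; B\<^sup>T, I]\<close> gives \<open>det(x y I - B B\<^sup>T) y^m1 / y^n1\<close>, and \<open>B B\<^sup>T = A(G1) + r1 I\<close> by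
  regularity. The division is legitimate because \<open>y det M\<close> is the characteristic polynomial of the
  cone over \<open>G2\<close>.
\<close>

section \<open>Determinants of matrices indexed by lists\<close>

text \<open>
  Matrices with rows and columns indexed by the elements of a list; for a distinct list the
  determinant depends only on its set of elements, so blocks are sublists.
\<close>

definition idx_det :: "('i \<Rightarrow> 'i \<Rightarrow> 'k :: comm_ring_1) \<Rightarrow> 'i list \<Rightarrow> 'k" where
  "idx_det f xs = det (mat (length xs) (length xs) (\<lambda>(i, j). f (xs ! i) (xs ! j)))"

lemma idx_det_cong:
  assumes "\<And>x y. x \<in> set xs \<Longrightarrow> y \<in> set xs \<Longrightarrow> f x y = g x y"
  shows "idx_det f xs = idx_det g xs"
  unfolding idx_det_def using assms by (intro arg_cong[of _ _ det] eq_matI) auto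

lemma idx_det_map: "idx_det f (map h xs) = idx_det (\<lambda>x y. f (h x) (h y)) xs"
  unfolding idx_det_def by (intro arg_cong[of _ _ det] eq_matI) auto

lemma idx_det_scalar:
  assumes "distinct xs"
  shows "idx_det (\<lambda>x y. if x = y then c else 0) xs = c ^ length xs"
proof -
  have "mat (length xs) (length xs) (\<lambda>(i, j). if xs ! i = xs ! j then c else 0)
      = c \<cdot>\<^sub>m 1\<^sub>m (length xs)"
    using assms by (intro eq_matI) (auto simp: nth_eq_iff_index_eq)
  thus ?thesis by (simp add: idx_det_def)
qed

text \<open>Reordering the list permutes rows and columns by the same permutation \<open>p\<close>,
  so its sign enters twice and cancels. This is what makes the choice of vertex enumeration
  immaterial.\<close>

lemma idx_det_perm:
  fixes f :: "'i \<Rightarrow> 'i \<Rightarrow> 'k :: comm_ring_1"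
  assumes "distinct xs" "distinct ys" "set xs = set ys"
  shows "idx_det f xs = idx_det f ys"
proof -
  have "mset xs = mset ys" using assms by (simp add: set_eq_iff_mset_eq_distinct)
  then obtain p where p: "p permutes {..<length ys}" "permute_list p ys = xs"
    by (rule mset_eq_permutation)
  define n where "n = length ys"
  have len: "length xs = n" using p by (auto simp: n_def)
  have p0: "p permutes {0..<n}" using p by (simp add: n_def lessThan_atLeast0)
  have pn: "p i < n" if "i < n" for i using permutes_in_image[OF p0, of i] that by simp
  have xs: "xs ! i = ys ! p i" if "i < n" for i
    using permute_list_nth[OF p(1), of i] p(2) that by (simp add: n_def)
  define A where "A = mat n n (\<lambda>(i, j). f (ys ! i) (ys ! j))"
  have A: "A \<in> carrier_mat n n" by (simp add: A_def)
  \<comment> \<open>\<open>B\<close> permutes the rows of \<open>A\<close>, and \<open>C\<close> the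
    rows of the transpose of \<open>B\<close>, that is, the columns of \<open>B\<close>. A rule for
    row permutations therefore suffices.\<close>
  define B where "B = mat n n (\<lambda>(i, j). A $$ (p i, j))"
  have B: "B \<in> carrier_mat n n" "B\<^sup>T \<in> carrier_mat n n" by (auto simp: B_def)
  define C where "C = mat n n (\<lambda>(i, j). B\<^sup>T $$ (p i, j))"
  have C: "C \<in> carrier_mat n n" by (simp add: C_def)
  have sgn: "signof p * signof p = (1 :: 'k)"
    by (simp add: sign_def)
  have "idx_det f xs = det C\<^sup>T"
    unfolding idx_det_def len using xs pn
    by (intro arg_cong[of _ _ det] eq_matI) (auto simp: C_def B_def A_def)
  also have "\<dots> = signof p * (signof p * det A)"
    using det_permute_rows[OF A p0] det_permute_rows[OF B(2) p0] det_transpose[OF B(1)]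
      det_transpose[OF C]
    by (simp add: B_def[symmetric] C_def[symmetric])
  also have "\<dots> = idx_det f ys"
    by (simp add: mult.assoc[symmetric] sgn idx_det_def A_def n_def)
  finally show ?thesis .
qed

lemma sum_nth_distinct:
  assumes "distinct xs"
  shows "(\<Sum>i = 0..<length xs. f (xs ! i)) = sum f (set xs)"
  using sum.reindex_bij_betw[OF bij_betw_nth[OF assms refl refl]]
  by (simp add: lessThan_atLeast0)

lemma idx_det_mult:
  assumes "distinct xs"
  shows "idx_det (\<lambda>x y. \<Sum>z\<in>set xs. f x z * g z y) xs = idx_det f xs * idx_det g xs"
proof -
  let ?n = "length xs"
  let ?M = "\<lambda>h. mat ?n ?n (\<lambda>(i, j). h (xs ! i) (xs ! j))"
  have "?M (\<lambda>x y. \<Sum>z\<in>set xs. f x z * g z y) = ?M f * ?M g"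
    by (intro eq_matI)
      (auto simp: scalar_prod_def sum_nth_distinct[OF assms, symmetric] intro!: sum.cong)
  thus ?thesis unfolding idx_det_def by (simp add: det_mult[of _ ?n])
qed

lemma idx_det_append_lower_left_zero:
  fixes f :: "'i \<Rightarrow> 'i \<Rightarrow> 'k :: idom"
  assumes "\<And>x y. x \<in> set ys \<Longrightarrow> y \<in> set xs \<Longrightarrow> f x y = 0"
  shows "idx_det f (xs @ ys) = idx_det f xs * idx_det f ys"
proof -
  let ?n = "length xs" and ?m = "length ys"
  let ?M = "\<lambda>us vs. mat (length us) (length vs) (\<lambda>(i, j). f (us ! i) (vs ! j))"
  have "?M (xs @ ys) (xs @ ys) = four_block_mat (?M xs xs) (?M xs ys) (?M ys xs) (?M ys ys)"
    by (intro eq_matI) (auto simp: nth_append)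
  moreover have "?M ys xs = 0\<^sub>m ?m ?n"
    using assms by (intro eq_matI) auto
  ultimately show ?thesis unfolding idx_det_def
    by (simp add: det_four_block_mat_lower_left_zero[of _ ?n _ ?m])
qed

lemma idx_det_append_upper_right_zero:
  fixes f :: "'i \<Rightarrow> 'i \<Rightarrow> 'k :: idom"
  assumes "\<And>x y. x \<in> set xs \<Longrightarrow> y \<in> set ys \<Longrightarrow> f x y = 0"
  shows "idx_det f (xs @ ys) = idx_det f xs * idx_det f ys"
proof -
  let ?n = "length xs" and ?m = "length ys"
  let ?M = "\<lambda>us vs. mat (length us) (length vs) (\<lambda>(i, j). f (us ! i) (vs ! j))"
  have "?M (xs @ ys) (xs @ ys) = four_block_mat (?M xs xs) (?M xs ys) (?M ys xs) (?M ys ys)"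
    by (intro eq_matI) (auto simp: nth_append)
  moreover have "?M xs ys = 0\<^sub>m ?n ?m"
    using assms by (intro eq_matI) auto
  ultimately show ?thesis unfolding idx_det_def
    by (simp add: det_four_block_mat_upper_right_zero[of _ ?n _ ?m])
qed

lemma idx_det_block_diagonal:
  fixes M :: "'v \<Rightarrow> 'v \<Rightarrow> 'k :: idom"
  assumes "distinct es"
  shows "idx_det (\<lambda>(a, u) (b, v). if a = b then M u v else 0) (List.product es vs)
    = idx_det M vs ^ length es"
  using assms
proof (induction es)
  case Nil
  then show ?case by (simp add: idx_det_def)
next
  case (Cons e es)
  let ?F = "\<lambda>(a, u) (b, v). if a = b then M u v else 0"
  have "idx_det ?F (List.product (e # es) vs)
      = idx_det ?F (map (Pair e) vs) * idx_det ?F (List.product es vs)"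
    using Cons.prems by (simp, subst idx_det_append_lower_left_zero) auto
  with Cons show ?case by (simp add: idx_det_map)
qed

section \<open>Block elimination for coronas and bipartite matrices\<close>

text \<open>For each \<open>b\<close> in \<open>es\<close>, the columns \<open>Inr (b, v)\<close>
  weighted by \<open>u v\<close> are added to column \<open>Inl b\<close>. Since \<open>M\<close>
  maps \<open>u\<close> to the all-ones vector, this clears the lower left block and lowers the
  diagonal entry at \<open>b\<close> by the sum of \<open>u\<close>. The base matrix
  \<open>f\<close> is arbitrary, so the lemma covers both the subdivision graph and the one-vertex
  base of a cone.\<close>

lemma idx_det_corona:
  fixes f :: "'w \<Rightarrow> 'w \<Rightarrow> 'k :: idom" and M :: "'v \<Rightarrow> 'v \<Rightarrow> 'k"
    and F :: "'w + 'w \<times> 'v \<Rightarrow> 'w + 'w \<times> 'v \<Rightarrow> 'k"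
  assumes "distinct ss" "distinct es" "set es \<subseteq> set ss" "distinct vs"
    and u: "\<And>v. v \<in> set vs \<Longrightarrow> (\<Sum>v'\<in>set vs. M v v' * u v') = 1"
    and F: "\<And>a b. a \<in> set ss \<Longrightarrow> b \<in> set ss \<Longrightarrow> F (Inl a) (Inl b) = f a b"
      "\<And>a b v. a \<in> set ss \<Longrightarrow> b \<in> set es \<Longrightarrow> v \<in> set vs \<Longrightarrow>
        F (Inl a) (Inr (b, v)) = (if a = b then -1 else 0)"
      "\<And>a b v. a \<in> set ss \<Longrightarrow> b \<in> set es \<Longrightarrow> v \<in> set vs \<Longrightarrow>
        F (Inr (b, v)) (Inl a) = (if a = b then -1 else 0)"
      "\<And>a b v v'. a \<in> set es \<Longrightarrow> b \<in> set es \<Longrightarrow> v \<in> set vs \<Longrightarrow> v' \<in> set vs \<Longrightarrow>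
        F (Inr (a, v)) (Inr (b, v')) = (if a = b then M v v' else 0)"
  shows "idx_det F (map Inl ss @ map Inr (List.product es vs))
    = idx_det (\<lambda>a b. f a b - (if a = b \<and> a \<in> set es then sum u (set vs) else 0)) ss
      * idx_det M vs ^ length es"
proof -
  let ?L = "map Inl ss :: ('w + 'w \<times> 'v) list"
  let ?R = "map Inr (List.product es vs) :: ('w + 'w \<times> 'v) list"
  \<comment> \<open>Right multiplication by \<open>N\<close> performs the column operations;
    \<open>N\<close> is lower unitriangular in the block order, so its determinant is 1.\<close>
  define N :: "'w + 'w \<times> 'v \<Rightarrow> 'w + 'w \<times> 'v \<Rightarrow> 'k" where
    "N = (\<lambda>x y. if x = y then 1 else case (x, y) of
      (Inr (a, v), Inl b) \<Rightarrow> if a = b then u v else 0 | _ \<Rightarrow> 0)"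
  have dist: "distinct (?L @ ?R)"
    using assms by (auto simp: distinct_map distinct_product)
  have setE: "set (?L @ ?R) = Inl ` set ss \<union> Inr ` (set es \<times> set vs)" by auto
  have NN: "N (Inl a) (Inl b) = (if a = b then 1 else 0)"
    "N (Inl a) (Inr q) = 0" "N (Inr (c, v)) (Inl b) = (if c = b then u v else 0)"
    "N (Inr q) (Inr q') = (if q = q' then 1 else 0)" for a b c v q q'
    by (auto simp: N_def)
  have detN: "idx_det N (?L @ ?R) = 1"
  proof -
    have "idx_det N (?L @ ?R) = idx_det N ?L * idx_det N ?R"
      by (rule idx_det_append_upper_right_zero) (auto simp: NN)
    also have "idx_det N ?L = 1"
      using idx_det_scalar[OF assms(1), of "1 :: 'k"] by (simp add: idx_det_map NN)
    also have "idx_det N ?R = 1"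
      using idx_det_scalar[of "List.product es vs" "1 :: 'k"] assms
      by (simp add: idx_det_map NN distinct_product)
    finally show ?thesis by simp
  qed
  define P where "P = (\<lambda>x y. \<Sum>z\<in>set (?L @ ?R). F x z * N z y)"
  have P: "P x y = (\<Sum>a\<in>set ss. F x (Inl a) * N (Inl a) y)
      + (\<Sum>e\<in>set es. \<Sum>v\<in>set vs. F x (Inr (e, v)) * N (Inr (e, v)) y)" for x y
  proof -
    have "P x y = (\<Sum>z\<in>Inl ` set ss. F x z * N z y)
        + (\<Sum>z\<in>Inr ` (set es \<times> set vs). F x z * N z y)"
      unfolding P_def setE by (rule sum.union_disjoint) auto
    also have "(\<Sum>z\<in>Inl ` set ss. F x z * N z y) = (\<Sum>a\<in>set ss. F x (Inl a) * N (Inl a) y)"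
      by (subst sum.reindex) auto
    also have "(\<Sum>z\<in>Inr ` (set es \<times> set vs). F x z * N z y)
        = (\<Sum>e\<in>set es. \<Sum>v\<in>set vs. F x (Inr (e, v)) * N (Inr (e, v)) y)"
      by (subst sum.reindex) (auto simp: sum.cartesian_product intro!: sum.cong)
    finally show ?thesis .
  qed
  have PL: "P x (Inl b) = F x (Inl b) + (if b \<in> set es then \<Sum>v\<in>set vs. F x (Inr (b, v)) * u v else 0)"
    if "b \<in> set ss" for x b
  proof -
    have "(\<Sum>a\<in>set ss. F x (Inl a) * N (Inl a) (Inl b)) = F x (Inl b)"
      using that by (simp add: NN if_distrib[of "(*) _"] cong: if_cong)
    moreover have "(\<Sum>e\<in>set es. \<Sum>v\<in>set vs. F x (Inr (e, v)) * N (Inr (e, v)) (Inl b))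
      = (\<Sum>e\<in>set es. if e = b then \<Sum>v\<in>set vs. F x (Inr (e, v)) * u v else 0)"
      by (intro sum.cong) (auto simp: NN)
    ultimately show ?thesis by (simp add: P)
  qed
  have PR: "P x (Inr (b, v)) = F x (Inr (b, v))" if "b \<in> set es" "v \<in> set vs" for x b v
  proof -
    have "(\<Sum>e\<in>set es. \<Sum>v'\<in>set vs. F x (Inr (e, v')) * N (Inr (e, v')) (Inr (b, v)))
      = (\<Sum>e\<in>set es. if e = b then \<Sum>v'\<in>set vs. if v' = v then F x (Inr (e, v')) else 0 else 0)"
      by (intro sum.cong) (auto simp: NN if_distrib[of "(*) _"] cong: if_cong)
    thus ?thesis using that by (simp add: P NN)
  qed
  have "idx_det F (?L @ ?R) = idx_det P (?L @ ?R)"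
    using idx_det_mult[OF dist, of F N] by (simp only: detN P_def mult_1_right)
  also have "\<dots> = idx_det P ?L * idx_det P ?R"
  proof (rule idx_det_append_lower_left_zero)
    fix x y assume x: "x \<in> set ?R" and y: "y \<in> set ?L"
    obtain e v where x': "x = Inr (e, v)" "e \<in> set es" "v \<in> set vs" using x by auto
    obtain b where y': "y = Inl b" "b \<in> set ss" using y by auto
    \<comment> \<open>For \<open>b = e\<close> the entry is -1 plus row \<open>v\<close> of
      \<open>M\<close> applied to \<open>u\<close>, which is 1; for \<open>b \<noteq> e\<close>
      every term vanishes.\<close>
    show "P x y = 0" using x' y' u[of v] by (auto simp: PL F cong: sum.cong_simp)
  qed
  also have "idx_det P ?R
      = idx_det (\<lambda>(a, u) (b, v). if a = b then M u v else 0) (List.product es vs)"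
    unfolding idx_det_map by (rule idx_det_cong) (auto simp: PR F)
  also have "\<dots> = idx_det M vs ^ length es"
    by (rule idx_det_block_diagonal) fact
  also have "idx_det P ?L
      = idx_det (\<lambda>a b. f a b - (if a = b \<and> a \<in> set es then sum u (set vs) else 0)) ss"
    unfolding idx_det_map by (rule idx_det_cong) (use assms(3) in \<open>auto simp: PL F sum_negf cong: sum.cong_simp\<close>)
  finally show ?thesis .
qed

text \<open>Right multiplication by the block matrix \<open>[y I, 0; inc^T, I]\<close>, of
  determinant \<open>y ^ length vs\<close>, turns the lower left block into
  \<open>- y inc^T + y inc^T = 0\<close>. The power of \<open>y\<close> stays on the left because
  the ring is only an integral domain and \<open>y\<close> may be zero here.\<close>

lemma idx_det_bipartite:
  fixes inc :: "'a \<Rightarrow> 'b \<Rightarrow> 'k :: idom" and F :: "'a + 'b \<Rightarrow> 'a + 'b \<Rightarrow> 'k"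
  assumes "distinct vs" "distinct es"
    and F: "\<And>v w. v \<in> set vs \<Longrightarrow> w \<in> set vs \<Longrightarrow> F (Inl v) (Inl w) = (if v = w then x else 0)"
      "\<And>v e. v \<in> set vs \<Longrightarrow> e \<in> set es \<Longrightarrow> F (Inl v) (Inr e) = - inc v e"
      "\<And>v e. v \<in> set vs \<Longrightarrow> e \<in> set es \<Longrightarrow> F (Inr e) (Inl v) = - inc v e"
      "\<And>e e'. e \<in> set es \<Longrightarrow> e' \<in> set es \<Longrightarrow> F (Inr e) (Inr e') = (if e = e' then y else 0)"
  shows "idx_det F (map Inl vs @ map Inr es) * y ^ length vs
    = idx_det (\<lambda>v w. (if v = w then x * y else 0) - (\<Sum>e\<in>set es. inc v e * inc w e)) vs
      * y ^ length es"
proof -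
  let ?L = "map Inl vs :: ('a + 'b) list" and ?R = "map Inr es :: ('a + 'b) list"
  define N :: "'a + 'b \<Rightarrow> 'a + 'b \<Rightarrow> 'k" where
    "N = (\<lambda>p q. case (p, q) of (Inl v, Inl w) \<Rightarrow> if v = w then y else 0
      | (Inl v, Inr e) \<Rightarrow> 0 | (Inr e, Inl v) \<Rightarrow> inc v e
      | (Inr e, Inr e') \<Rightarrow> if e = e' then 1 else 0)"
  have dist: "distinct (?L @ ?R)" using assms by (auto simp: distinct_map)
  have detN: "idx_det N (?L @ ?R) = y ^ length vs"
  proof -
    have "idx_det N (?L @ ?R) = idx_det N ?L * idx_det N ?R"
      by (rule idx_det_append_upper_right_zero) (auto simp: N_def)
    thus ?thesis using assms by (simp add: idx_det_map N_def idx_det_scalar)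
  qed
  define P where "P = (\<lambda>p q. \<Sum>z\<in>set (?L @ ?R). F p z * N z q)"
  have P: "P p q = (\<Sum>v\<in>set vs. F p (Inl v) * N (Inl v) q)
      + (\<Sum>e\<in>set es. F p (Inr e) * N (Inr e) q)" for p q
  proof -
    have "P p q = (\<Sum>z\<in>Inl ` set vs. F p z * N z q) + (\<Sum>z\<in>Inr ` set es. F p z * N z q)"
      unfolding P_def set_append set_map by (rule sum.union_disjoint) auto
    thus ?thesis by (simp add: sum.reindex)
  qed
  have PL: "P p (Inl w) = F p (Inl w) * y + (\<Sum>e\<in>set es. F p (Inr e) * inc w e)"
    if "w \<in> set vs" for p w
    using that by (simp add: P N_def if_distrib[of "(*) _"] cong: if_cong)
  have PR: "P p (Inr e) = F p (Inr e)" if "e \<in> set es" for p e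
    using that by (simp add: P N_def if_distrib[of "(*) _"] cong: if_cong)
  have "idx_det F (?L @ ?R) * y ^ length vs = idx_det P (?L @ ?R)"
    using idx_det_mult[OF dist, of F N] by (simp only: detN P_def)
  also have "\<dots> = idx_det P ?L * idx_det P ?R"
    by (rule idx_det_append_lower_left_zero)
      (auto simp: PL F if_distrib[of "\<lambda>z. z * _"] cong: if_cong sum.cong_simp)
  also have "idx_det P ?R = y ^ length es"
    unfolding idx_det_scalar[OF assms(2), symmetric] idx_det_map
    by (rule idx_det_cong) (auto simp: PR F)
  also have "idx_det P ?L
      = idx_det (\<lambda>v w. (if v = w then x * y else 0) - (\<Sum>e\<in>set es. inc v e * inc w e)) vs"
    unfolding idx_det_map by (rule idx_det_cong) (auto simp: PL F sum_negf cong: sum.cong_simp)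
  finally show ?thesis .
qed

section \<open>Real spectrum of symmetric matrices\<close>

text \<open>For an eigenvector \<open>v\<close>, the Hermitian form \<open>s = v* A v\<close> equals
  its own conjugate by symmetry, and also equals \<open>z * t\<close> with \<open>t\<close> the
  squared norm of \<open>v\<close>, a nonzero real.\<close>

lemma symmetric_real_mat_eigenvalue_real:
  fixes A :: "real mat"
  assumes A: "A \<in> carrier_mat n n" and sym: "A\<^sup>T = A"
    and ev: "eigenvalue (map_mat complex_of_real A) z"
  shows "z \<in> \<real>"
proof -
  let ?B = "map_mat complex_of_real A"
  from ev obtain v where v: "v \<in> carrier_vec n" "v \<noteq> 0\<^sub>v n" "?B *\<^sub>v v = z \<cdot>\<^sub>v v"
    using A by (auto simp: eigenvalue_def eigenvector_def)
  define s where "s = (\<Sum>i<n. \<Sum>j<n. of_real (A $$ (i, j)) * v $ j * cnj (v $ i))"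
  define t where "t = (\<Sum>i<n. (norm (v $ i))\<^sup>2)"
  have Asym: "A $$ (i, j) = A $$ (j, i)" if "i < n" "j < n" for i j
    using that A sym index_transpose_mat(1)[of i A j] by simp
  have "cnj s = (\<Sum>i<n. \<Sum>j<n. of_real (A $$ (j, i)) * v $ i * cnj (v $ j))"
    unfolding s_def by (simp add: Asym mult_ac)
  also have "\<dots> = s" unfolding s_def by (rule sum.swap)
  finally have s: "s \<in> \<real>" by (simp add: Reals_cnj_iff)
  have row: "(\<Sum>j<n. of_real (A $$ (i, j)) * v $ j) = z * v $ i" if "i < n" for i
  proof -
    have "(?B *\<^sub>v v) $ i = (z \<cdot>\<^sub>v v) $ i" by (simp only: v(3))
    thus ?thesis using that A v(1) by (simp add: scalar_prod_def lessThan_atLeast0)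
  qed
  have "s = (\<Sum>i<n. (\<Sum>j<n. of_real (A $$ (i, j)) * v $ j) * cnj (v $ i))"
    by (simp add: s_def sum_distrib_right)
  also have "\<dots> = (\<Sum>i<n. z * (v $ i * cnj (v $ i)))"
    by (intro sum.cong) (auto simp: row)
  also have "\<dots> = z * of_real t"
    by (simp add: t_def sum_distrib_left complex_norm_square flip: of_real_power)
  finally have st: "s = z * of_real t" .
  have "t \<noteq> 0"
  proof
    assume "t = 0"
    hence "v $ i = 0" if "i < n" for i
      using that by (simp add: t_def sum_nonneg_eq_0_iff)
    hence "v = 0\<^sub>v n" using v(1) by (intro eq_vecI) auto
    with v(2) show False by simp
  qed
  hence "z = s / of_real t" by (simp add: st)
  thus ?thesis using s by simp
qed

text \<open>Induction on the degree: the fundamental theorem of algebra gives a complex root, which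
  is real by hypothesis and splits off a linear factor; the quotient is again monic with only real
  roots.\<close>

lemma monic_poly_real_roots_split:
  fixes p :: "real poly"
  assumes "monic p" and "\<And>z. poly (map_poly complex_of_real p) z = 0 \<Longrightarrow> z \<in> \<real>"
  shows "p = (\<Prod>a\<in>#proots p. [:- a, 1:]) \<and> size (proots p) = degree p"
  using assms
proof (induction "degree p" arbitrary: p)
  case 0
  then have "p = 1" by (simp add: monic_degree_0)
  then show ?case by simp
next
  case (Suc n)
  interpret P: map_poly_comm_ring_hom complex_of_real ..
  have "\<not> constant (poly (map_poly complex_of_real p))"
    using Suc.hyps(2) by (simp add: constant_degree)
  then obtain z where z: "poly (map_poly complex_of_real p) z = 0"
    using fundamental_theorem_of_algebra by blast
  with Suc.prems(2) obtain a where a: "z = of_real a" by (auto elim: Reals_cases)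
  have "poly p a = 0" using z unfolding a by simp
  then obtain q where q: "p = [:- a, 1:] * q" by (auto simp: poly_eq_0_iff_dvd)
  have "p \<noteq> 0" using Suc.prems(1) by auto
  hence q0: "q \<noteq> 0" using q by auto
  have mq: "monic q" using Suc.prems(1) unfolding q lead_coeff_mult by simp
  have dq: "n = degree q" using Suc.hyps(2) q0 unfolding q by (subst (asm) degree_mult_eq) auto
  have "poly (map_poly complex_of_real q) z = 0 \<Longrightarrow> z \<in> \<real>" for z
    using Suc.prems(2)[of z] unfolding q P.hom_mult by simp
  from Suc.hyps(1)[OF dq mq this]
  have IH: "q = (\<Prod>a\<in>#proots q. [:- a, 1:])" "size (proots q) = degree q" by auto
  have "proots p = add_mset a (proots q)"
    unfolding q using q0 by (subst proots_mult) auto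
  thus ?case using IH q Suc.hyps(2) dq by simp
qed

text \<open>The size claim ensures that \<open>nth_eigenvalue A i\<close> is a genuine list entry
  for every \<open>i\<close> from 1 to \<open>n\<close>.\<close>

lemma char_poly_symmetric_real_mat_split:
  fixes A :: "real mat"
  assumes A: "A \<in> carrier_mat n n" and sym: "A\<^sup>T = A"
  shows "char_poly A = (\<Prod>a\<in>#proots (char_poly A). [:- a, 1:])"
    and "size (proots (char_poly A)) = n"
proof -
  have "z \<in> \<real>" if "poly (map_poly complex_of_real (char_poly A)) z = 0" for z
  proof (rule symmetric_real_mat_eigenvalue_real[OF A sym])
    show "eigenvalue (map_mat complex_of_real A) z"
      using that A by (simp add: eigenvalue_root_char_poly[of _ n] of_real_hom.char_poly_hom[OF A])
  qed
  from monic_poly_real_roots_split[OF _ this] degree_monic_char_poly[OF A]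
  show "char_poly A = (\<Prod>a\<in>#proots (char_poly A). [:- a, 1:])"
    and "size (proots (char_poly A)) = n" by auto
qed

section \<open>Characteristic matrices and the coronal over the rational functions\<close>

definition charmat_entry :: "('i \<Rightarrow> 'i \<Rightarrow> real) \<Rightarrow> 'i \<Rightarrow> 'i \<Rightarrow> real poly fract" where
  "charmat_entry a u v = (if u = v then ratfun_X else 0) - ratfun_const (a u v)"

text \<open>Arbitrary real entries are allowed, so that cones are covered along with adjacency
  matrices of graphs.\<close>

definition indexed_mat :: "('i \<Rightarrow> 'i \<Rightarrow> real) \<Rightarrow> 'i list \<Rightarrow> real mat" where
  "indexed_mat a vs = mat (length vs) (length vs) (\<lambda>(i, j). a (vs ! i) (vs ! j))"

lemma indexed_mat_carrier: "indexed_mat a vs \<in> carrier_mat (length vs) (length vs)"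
  by (simp add: indexed_mat_def)

lemma map_mat_to_fract_char_poly_matrix:
  assumes "distinct vs"
  shows "map_mat to_fract (char_poly_matrix (indexed_mat a vs))
    = mat (length vs) (length vs) (\<lambda>(i, j). charmat_entry a (vs ! i) (vs ! j))"
  using assms
  by (intro eq_matI)
    (auto simp: char_poly_matrix_def indexed_mat_def charmat_entry_def nth_eq_iff_index_eq
      simp flip: to_fract_diff to_fract_uminus)

lemma to_fract_char_poly:
  assumes "distinct vs"
  shows "to_fract (char_poly (indexed_mat a vs)) = idx_det (charmat_entry a) vs"
proof -
  interpret inj_idom_hom "to_fract :: real poly \<Rightarrow> real poly fract"
    by unfold_locales auto
  show ?thesis
    unfolding idx_det_def map_mat_to_fract_char_poly_matrix[OF assms, symmetric]
    by (simp add: char_poly_def)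
qed

lemma idx_det_charmat_entry_nonzero:
  assumes "distinct vs"
  shows "idx_det (charmat_entry a) vs \<noteq> 0"
  using degree_monic_char_poly[OF indexed_mat_carrier, of a vs]
  by (auto simp: to_fract_char_poly[OF assms, symmetric])

text \<open>Here \<open>u\<close> is the inverse of the characteristic matrix applied to the
  all-ones vector, read as a function of the indices. It is the solution that
  \<open>idx_det_corona\<close> asks for.\<close>

lemma coronal_eq_sum:
  assumes "distinct vs"
  obtains u where "\<And>v. v \<in> set vs \<Longrightarrow> (\<Sum>v'\<in>set vs. charmat_entry a v v' * u v') = 1"
    and "coronal (indexed_mat a vs) = sum u (set vs)"
proof -
  let ?n = "length vs"
  let ?X = "mat ?n ?n (\<lambda>(i, j). charmat_entry a (vs ! i) (vs ! j))"
  let ?ones = "vec ?n (\<lambda>_. 1) :: real poly fract vec"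
  note X = map_mat_to_fract_char_poly_matrix[OF assms, of a]
  obtain B where B: "mat_inverse ?X = Some B"
    using coronal_inverse_exists[OF indexed_mat_carrier, of a vs] unfolding X by blast
  have inv: "?X * B = 1\<^sub>m ?n" "B \<in> carrier_mat ?n ?n"
    using mat_inverse(2)[OF _ B, of ?n] by auto
  define w where "w = B *\<^sub>v ?ones"
  have w: "w \<in> carrier_vec ?n" using inv by (auto simp: w_def)
  have "?X *\<^sub>v w = (?X * B) *\<^sub>v ?ones"
    unfolding w_def using inv by (subst assoc_mult_mat_vec[of _ ?n ?n _ ?n]) auto
  hence Xw: "?X *\<^sub>v w = ?ones" using inv by simp
  \<comment> \<open>The inverse of \<open>(!) vs\<close> gives the position of \<open>v\<close> in
    the distinct list \<open>vs\<close>.\<close>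
  define u where "u v = w $ the_inv_into {..<?n} ((!) vs) v" for v
  have u: "u (vs ! i) = w $ i" if "i < ?n" for i
    using that assms by (simp add: u_def the_inv_into_f_f inj_on_nth)
  show ?thesis
  proof (rule that)
    fix v assume "v \<in> set vs"
    then obtain i where i: "i < ?n" "v = vs ! i" by (auto simp: in_set_conv_nth)
    have "(\<Sum>v'\<in>set vs. charmat_entry a v v' * u v')
        = (\<Sum>j = 0..<?n. charmat_entry a v (vs ! j) * u (vs ! j))"
      by (rule sum_nth_distinct[OF assms, symmetric])
    also have "\<dots> = (?X *\<^sub>v w) $ i"
      using i w u by (simp add: scalar_prod_def)
    finally show "(\<Sum>v'\<in>set vs. charmat_entry a v v' * u v') = 1" using i by (simp add: Xw)
  next
    have "coronal (indexed_mat a vs) = ?ones \<bullet> w"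
      unfolding coronal_def X B w_def by (simp add: indexed_mat_def Let_def)
    also have "\<dots> = (\<Sum>j = 0..<?n. u (vs ! j))"
      using w u by (simp add: scalar_prod_def)
    finally show "coronal (indexed_mat a vs) = sum u (set vs)"
      by (simp add: sum_nth_distinct[OF assms])
  qed
qed

text \<open>Multiplied by the characteristic polynomial of the matrix, this difference becomes the
  characteristic polynomial of the cone, which is monic and hence nonzero.\<close>

lemma ratfun_X_minus_coronal_nonzero:
  assumes "distinct vs"
  shows "ratfun_X - coronal (indexed_mat a vs) \<noteq> 0"
proof -
  obtain u where u: "\<And>v. v \<in> set vs \<Longrightarrow> (\<Sum>v'\<in>set vs. charmat_entry a v v' * u v') = 1"
    and cor: "coronal (indexed_mat a vs) = sum u (set vs)"
    by (rule coronal_eq_sum[OF assms, of a]) blast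
  \<comment> \<open>The apex \<open>Inl ()\<close> has diagonal entry 0 and entry 1 with every other
    index. The cone is thus a corona over a single base vertex.\<close>
  define cone :: "unit + unit \<times> 'a \<Rightarrow> unit + unit \<times> 'a \<Rightarrow> real" where
    "cone = (\<lambda>x y. case (x, y) of (Inl _, Inl _) \<Rightarrow> 0 | (Inr (_, v), Inr (_, w)) \<Rightarrow> a v w | _ \<Rightarrow> 1)"
  let ?ws = "map Inl [()] @ map Inr (List.product [()] vs)"
  have "idx_det (charmat_entry cone) ?ws
      = idx_det (\<lambda>a b. ratfun_X - (if a = b \<and> a \<in> set [()] then sum u (set vs) else 0)) [()]
        * idx_det (charmat_entry a) vs ^ length [()]"
    by (rule idx_det_corona)
      (use assms u in \<open>auto simp: charmat_entry_def cone_def simp flip: one_pCons\<close>)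
  moreover have "idx_det (charmat_entry cone) ?ws \<noteq> 0"
    by (rule idx_det_charmat_entry_nonzero) (use assms in \<open>auto simp: distinct_map inj_on_def\<close>)
  ultimately show ?thesis by (auto simp: cor idx_det_def det_single)
qed

section \<open>Characteristic polynomials evaluated at a rational function\<close>

text \<open>Substituting \<open>t\<close> for the indeterminate is a ring homomorphism
  \<open>h\<close>, so it commutes with the determinant and with the factorization of the
  characteristic polynomial into real linear factors.\<close>

lemma idx_det_scalar_minus_symmetric:
  fixes a :: "'i \<Rightarrow> 'i \<Rightarrow> real" and t :: "real poly fract"
  assumes dist: "distinct vs" and sym: "\<And>u v. a u v = a v u"
  shows "idx_det (\<lambda>u v. (if u = v then t else 0) - ratfun_const (a u v)) vs
    = (\<Prod>i = 1..length vs. t - ratfun_const (nth_eigenvalue (indexed_mat a vs) i))"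
proof -
  let ?n = "length vs" and ?A = "indexed_mat a vs"
  interpret C: comm_ring_hom ratfun_const
    by unfold_locales (auto simp flip: to_fract_add to_fract_mult simp: one_pCons[symmetric])
  interpret Cp: map_poly_comm_ring_hom ratfun_const ..
  define h where "h p = poly (map_poly ratfun_const p) t" for p
  interpret h: comm_ring_hom h
    by unfold_locales (auto simp: h_def Cp.hom_add Cp.hom_mult)
  have hlin: "h [:- c, 1:] = t - ratfun_const c" for c
    by (simp add: h_def C.hom_uminus)
  have hC: "h [:c:] = ratfun_const c" for c
    by (cases "c = 0") (simp_all add: h_def map_poly_pCons)
  have symA: "?A\<^sup>T = ?A" using sym by (intro eq_matI) (auto simp: indexed_mat_def)
  note split = char_poly_symmetric_real_mat_split[OF indexed_mat_carrier symA]
  \<comment> \<open>This is the decreasing list that \<open>nth_eigenvalue\<close> indexes, shifted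
    by one.\<close>
  define L where "L = rev (sorted_list_of_multiset (proots (char_poly ?A)))"
  have msL: "mset L = proots (char_poly ?A)" by (simp add: L_def)
  have lenL: "length L = ?n" using split(2) by (metis msL size_mset)
  have "mat ?n ?n (\<lambda>(i, j). (if vs ! i = vs ! j then t else 0) - ratfun_const (a (vs ! i) (vs ! j)))
      = map_mat h (char_poly_matrix ?A)"
    using dist
    by (intro eq_matI)
      (auto simp: char_poly_matrix_def indexed_mat_def nth_eq_iff_index_eq hlin[folded one_pCons] hC
        C.hom_uminus
        simp del: to_fract_uminus)
  hence "idx_det (\<lambda>u v. (if u = v then t else 0) - ratfun_const (a u v)) vs = h (char_poly ?A)"
    by (simp add: idx_det_def char_poly_def)
  also have "\<dots> = h (\<Prod>c\<leftarrow>L. [:- c, 1:])"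
    by (subst split(1)) (simp add: msL[symmetric] flip: prod_mset_prod_list)
  also have "\<dots> = (\<Prod>c\<leftarrow>L. t - ratfun_const c)"
    by (simp add: h.hom_prod_list hlin o_def)
  also have "\<dots> = (\<Prod>i = 0..<?n. t - ratfun_const (L ! i))"
    by (simp add: prod.list_conv_set_nth lenL)
  also have "\<dots> = (\<Prod>i = 1..?n. t - ratfun_const (nth_eigenvalue ?A i))"
    by (rule prod.reindex_bij_witness[of _ "\<lambda>i. i - 1" Suc])
      (auto simp: nth_eigenvalue_def L_def)
  finally show ?thesis .
qed

section \<open>Adjacency and incidence in a regular graph\<close>

definition adj :: "'a pair_pre_digraph \<Rightarrow> 'a \<Rightarrow> 'a \<Rightarrow> real" where
  "adj G u v = (if (u, v) \<in> parcs G then 1 else 0)"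

lemma adj_matrix_conv_indexed_mat: "adj_matrix G vs = indexed_mat (adj G) vs"
  by (simp add: adj_matrix_def indexed_mat_def adj_def)

text \<open>This is the entrywise form of \<open>B B^T = A + r I\<close>: the sum counts the edges
  containing both \<open>v\<close> and \<open>w\<close>. On the diagonal these are the
  \<open>r\<close> edges at \<open>v\<close>; off it, only \<open>{v, w}\<close> can
  qualify.\<close>

lemma sum_uedges_incidence:
  fixes G :: "'a pair_pre_digraph"
  assumes G: "pair_graph G" and reg: "regular_graph G r"
    and v: "v \<in> pverts G" and w: "w \<in> pverts G"
  shows "(\<Sum>e\<in>uedges G. (if v \<in> e then 1 else 0) * (if w \<in> e then 1 else 0))
    = (if v = w then of_nat r else 0) + (if (v, w) \<in> parcs G then 1 else (0 :: 'k :: comm_ring_1))"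
proof -
  interpret pair_graph G by fact
  have sym: "(y, x) \<in> parcs G" if "(x, y) \<in> parcs G" for x y
    using that pair_sym_arcs by (auto simp: symmetric_def dest: symD)
  have "uedges G = (\<lambda>(x, y). {x, y}) ` parcs G" by (auto simp: uedges_def)
  hence fin: "finite (uedges G)" using pair_finite_arcs by simp
  have "(\<Sum>e\<in>uedges G. (if v \<in> e then 1 else 0) * (if w \<in> e then 1 else (0 :: 'k)))
      = (\<Sum>e\<in>uedges G. if v \<in> e \<and> w \<in> e then 1 else 0)"
    by (intro sum.cong) auto
  also have "\<dots> = of_nat (card {e \<in> uedges G. v \<in> e \<and> w \<in> e})"
    using fin by (simp add: sum.If_cases Int_def)
  also have "\<dots> = (if v = w then of_nat r else 0) + (if (v, w) \<in> parcs G then 1 else 0)"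
  proof (cases "v = w")
    case True
    have noloop: "(v, v) \<notin> parcs G" using pair_no_loops[of "(v, v)"] by auto
    \<comment> \<open>Of the two arcs representing an edge at \<open>v\<close>, exactly one leaves
      \<open>v\<close>, so out-degree counts edges.\<close>
    have "bij_betw (\<lambda>(x, y). {x, y}) (out_arcs (with_proj G) v) {e \<in> uedges G. v \<in> e \<and> w \<in> e}"
      using sym True by (auto simp: bij_betw_def inj_on_def uedges_def doubleton_eq_iff image_iff)
        (metis insert_commute)+
    hence "card {e \<in> uedges G. v \<in> e \<and> w \<in> e} = r"
      using reg v by (simp add: regular_graph_def out_degree_def bij_betw_same_card[symmetric])
    thus ?thesis using True noloop by simp
  next
    case False
    hence "{e \<in> uedges G. v \<in> e \<and> w \<in> e} = (if (v, w) \<in> parcs G then {{v, w}} else {})"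
      using sym by (auto simp: uedges_def)
    thus ?thesis using False by simp
  qed
  finally show ?thesis .
qed

section \<open>Assembly of the characteristic polynomial of the corona\<close>

theorem theorem3p1:
  fixes G1 :: "'a pair_pre_digraph" and G2 :: "'b pair_pre_digraph"
    and r1 n1 m1 :: nat
    and vs1 :: "'a list" and vs2 :: "'b list"
    and ws :: "(('a + 'a set) + ('a + 'a set) \<times> 'b) list"
  assumes "pair_graph G1" and "pair_graph G2"
    and "regular_graph G1 r1"
    and "card (pverts G1) = n1" and "card (uedges G1) = m1"
    and "vertex_enum G1 vs1" and "vertex_enum G2 vs2" and "vertex_enum (G1 \<ominus>\<^sub>e G2) ws"
  shows "to_fract (char_poly (adj_matrix (G1 \<ominus>\<^sub>e G2) ws)) =
    to_fract (char_poly (adj_matrix G2 vs2)) ^ m1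
    * (ratfun_X - coronal (adj_matrix G2 vs2)) powi (int m1 - int n1)
    * (\<Prod>i = 1..n1. ratfun_X ^ 2 - coronal (adj_matrix G2 vs2) * ratfun_X
         - ratfun_const (nth_eigenvalue (adj_matrix G1 vs1) i) - of_nat r1)"
proof -
  interpret G1: pair_graph G1 by fact
  have vs1: "distinct vs1" "set vs1 = pverts G1" and vs2: "distinct vs2" "set vs2 = pverts G2"
    and ws: "distinct ws" "set ws = pverts (G1 \<ominus>\<^sub>e G2)"
    using assms by (auto simp: vertex_enum_def)
  have n1: "length vs1 = n1" using vs1 assms(4) distinct_card by fastforce
  have "uedges G1 = (\<lambda>(x, y). {x, y}) ` parcs G1" by (auto simp: uedges_def)
  hence "finite (uedges G1)" using G1.pair_finite_arcs by simp
  then obtain es where es: "distinct es" "set es = uedges G1" using finite_distinct_list by blast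
  have m1: "length es = m1" using es assms(5) distinct_card by fastforce
  \<comment> \<open>The given enumeration \<open>ws\<close> is arbitrary; \<open>ws'\<close> lists
    the original vertices, then the inserted ones, then the copies of \<open>G2\<close> one after
    another.\<close>
  define ss :: "('a + 'a set) list" where "ss = map Inl vs1 @ map Inr es"
  define ins :: "('a + 'a set) list" where "ins = map Inr es"
  define ws' :: "(('a + 'a set) + ('a + 'a set) \<times> 'b) list" where
    "ws' = map Inl ss @ map Inr (List.product ins vs2)"
  have ss: "distinct ss" "set ss = Inl ` pverts G1 \<union> Inr ` uedges G1"
    using vs1 es by (auto simp: ss_def distinct_map)
  have ins: "distinct ins" "set ins = Inr ` uedges G1" "length ins = m1"
    using es m1 by (auto simp: ins_def distinct_map)
  have ws': "distinct ws'" "set ws' = pverts (G1 \<ominus>\<^sub>e G2)"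
    using ss ins vs2 by (auto simp: ws'_def distinct_map distinct_product
        subdivision_edge_corona_def subdivision_graph_def inserted_verts_def)
  define \<Gamma> where "\<Gamma> = coronal (adj_matrix G2 vs2)"
  define y where "y = ratfun_X - \<Gamma>"
  have y0: "y \<noteq> 0"
    using ratfun_X_minus_coronal_nonzero[OF vs2(1)]
    by (simp add: y_def \<Gamma>_def adj_matrix_conv_indexed_mat)
  obtain u where u: "\<And>v. v \<in> set vs2 \<Longrightarrow> (\<Sum>v'\<in>set vs2. charmat_entry (adj G2) v v' * u v') = 1"
    and cor: "\<Gamma> = sum u (set vs2)"
    unfolding \<Gamma>_def adj_matrix_conv_indexed_mat
    by (rule coronal_eq_sum[OF vs2(1), of "adj G2"]) blast
  define \<phi>2 where "\<phi>2 = to_fract (char_poly (adj_matrix G2 vs2))"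
  have \<phi>2: "\<phi>2 = idx_det (charmat_entry (adj G2)) vs2"
    by (simp add: \<phi>2_def adj_matrix_conv_indexed_mat to_fract_char_poly[OF vs2(1)])
  let ?c = "charmat_entry (adj (G1 \<ominus>\<^sub>e G2))"
  \<comment> \<open>\<open>S\<close> is the characteristic matrix of the subdivision graph with
    \<open>\<Gamma>\<close> subtracted on the diagonal at inserted vertices, turning
    \<open>x\<close> into \<open>y\<close> there.\<close>
  define S where "S a b = ?c (Inl a) (Inl b) - (if a = b \<and> a \<in> set ins then \<Gamma> else 0)" for a b
  have "to_fract (char_poly (adj_matrix (G1 \<ominus>\<^sub>e G2) ws)) = idx_det ?c ws'"
    by (simp add: adj_matrix_conv_indexed_mat to_fract_char_poly[OF ws(1)]
        idx_det_perm[OF ws(1) ws'(1)] ws(2) ws'(2))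
  also have "\<dots> = idx_det S ss * \<phi>2 ^ m1"
    unfolding ws'_def \<phi>2 S_def cor ins(3)[symmetric]
    by (rule idx_det_corona)
      (use ss ins vs2 u in \<open>auto simp: charmat_entry_def adj_def subdivision_edge_corona_def
        inserted_verts_def simp flip: one_pCons\<close>)
  finally have 1: "to_fract (char_poly (adj_matrix (G1 \<ominus>\<^sub>e G2) ws)) = idx_det S ss * \<phi>2 ^ m1" .
  define inc :: "'a \<Rightarrow> 'a set \<Rightarrow> real poly fract" where "inc v e = (if v \<in> e then 1 else 0)" for v e
  \<comment> \<open>The summand \<open>r1 I\<close> of \<open>B B^T\<close> is absorbed into the
    scalar part, leaving \<open>t I - A(G1)\<close>.\<close>
  define t where "t = ratfun_X * y - of_nat r1"
  have "idx_det S ss * y ^ length vs1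
    = idx_det (\<lambda>v w. (if v = w then ratfun_X * y else 0) - (\<Sum>e\<in>set es. inc v e * inc w e)) vs1
      * y ^ length es"
    unfolding ss_def
    by (rule idx_det_bipartite)
      (use vs1 es in \<open>auto simp: S_def charmat_entry_def adj_def subdivision_edge_corona_def
        subdivision_graph_def ins inc_def y_def simp flip: one_pCons\<close>)
  also have "idx_det (\<lambda>v w. (if v = w then ratfun_X * y else 0) - (\<Sum>e\<in>set es. inc v e * inc w e)) vs1
      = idx_det (\<lambda>v w. (if v = w then t else 0) - ratfun_const (adj G1 v w)) vs1"
    by (rule idx_det_cong)
      (simp add: vs1 es inc_def sum_uedges_incidence[OF assms(1,3)] t_def adj_def flip: one_pCons)
  also have "\<dots> = (\<Prod>i = 1..n1. t - ratfun_const (nth_eigenvalue (adj_matrix G1 vs1) i))"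
    unfolding adj_matrix_conv_indexed_mat n1[symmetric]
  proof (rule idx_det_scalar_minus_symmetric[OF vs1(1)])
    show "adj G1 u v = adj G1 v u" for u v
      using G1.pair_sym_arcs by (auto simp: adj_def symmetric_def dest: symD)
  qed
  \<comment> \<open>Cancelling \<open>y ^ n1\<close> uses \<open>y \<noteq> 0\<close>; the integer
    power is needed because \<open>m1\<close> can be smaller than \<open>n1\<close>, as for
    1-regular graphs.\<close>
  finally have "idx_det S ss = y powi (int m1 - int n1)
      * (\<Prod>i = 1..n1. t - ratfun_const (nth_eigenvalue (adj_matrix G1 vs1) i))"
    using y0 by (simp add: power_int_diff n1 m1 field_simps)
  moreover have "t - c = ratfun_X ^ 2 - \<Gamma> * ratfun_X - c - of_nat r1" for c
    by (simp add: t_def y_def algebra_simps power2_eq_square)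
  ultimately show ?thesis
    by (simp add: 1 \<Gamma>_def[symmetric] y_def[symmetric] \<phi>2_def[symmetric] mult_ac)
qed

end
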